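(* Let $f(z)=\sum_{|\alpha|=d}a(\alpha)z^\alpha\in\mathbb{R}[z_1,\ldots,z_n]$ be a real homogeneous polynomial of degree $d$. If $f$ is real stable and $\alpha=(\alpha_1,\ldots,\alpha_n)\in\mathbb{N}^n$ and indices $i,j\in\{1,\ldots,n\}$ are such that $|\alpha|=d$ and $\alpha_i\ge\alpha_j>0$, then $$\hat a(\alpha+k(e_i-e_j))^2\ \ge\ \hat a(\alpha+(k-1)(e_i-e_j))\,\hat a(\alpha+(k+1)(e_i-e_j))$$ for all integers $k$ with $-\alpha_i+1\le k\le\alpha_j-1$.
   Context: $\mathbb{N}$ is the set of nonnegative integers. Multi-index notation: $z=(z_1,\ldots,z_n)$, $|\alpha|=\sum_{i=1}^n\alpha_i$, $z^\alpha=\prod_{i=1}^n z_i^{\alpha_i}$. $\{e_i\}_{i=1}^n$ is the standard basis of $\mathbb{R}^n$. For $\alpha\in\mathbb{N}^n$ with $|\alpha|=d$, $\binom{d}{\alpha}=\frac{d!}{\alpha_1!\cdots\alpha_n!}$, and the normalized coefficients of $f$ are $\hat a(\alpha)=\binom{d}{\alpha}^{-1}a(\alpha)$. A polynomial $f\in\mathbb{R}[z_1,\ldots,z_n]$ is real stable if $f(z_1,\ldots,z_n)\ne0$ for all $(z_1,\ldots,z_n)\in\mathbb{C}^n$ with $\operatorname{Im}(z_j)>0$ for $1\le j\le n$. *)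

theory Defs
  imports "HOL-Analysis.Analysis" "HOL-Library.Poly_Mapping"
begin

text \<open>
  \<^typ>\<open>nat ^ 'n\<close> is the additive monoid of exponent vectors, so the monoid algebra
  \<open>(nat ^ 'n) \<Rightarrow>\<^sub>0 real\<close> is the ring of real polynomials in variables indexed by
  \<^typ>\<open>'n\<close>; \<^const>\<open>Poly_Mapping.lookup\<close> returns the coefficient of a monomial.
\<close>

type_synonym 'n real_mpoly = "(nat ^ 'n) \<Rightarrow>\<^sub>0 real"

definition mindex_size :: "nat ^ 'n::finite \<Rightarrow> nat"
  where "mindex_size \<alpha> = (\<Sum>i\<in>UNIV. \<alpha> $ i)"

definition monomial_eval :: "complex ^ 'n::finite \<Rightarrow> nat ^ 'n \<Rightarrow> complex"
  where "monomial_eval z \<alpha> = (\<Prod>i\<in>UNIV. (z $ i) ^ (\<alpha> $ i))"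

definition mpoly_eval :: "'n::finite real_mpoly \<Rightarrow> complex ^ 'n \<Rightarrow> complex"
  where "mpoly_eval f z = (\<Sum>\<alpha>\<in>Poly_Mapping.keys f. complex_of_real (Poly_Mapping.lookup f \<alpha>) * monomial_eval z \<alpha>)"

definition homogeneous :: "nat \<Rightarrow> 'n::finite real_mpoly \<Rightarrow> bool"
  where "homogeneous d f \<longleftrightarrow> (\<forall>\<alpha>\<in>Poly_Mapping.keys f. mindex_size \<alpha> = d)"

definition real_stable :: "'n::finite real_mpoly \<Rightarrow> bool"
  where "real_stable f \<longleftrightarrow> (\<forall>z. (\<forall>j. Im (z $ j) > 0) \<longrightarrow> mpoly_eval f z \<noteq> 0)"

text \<open>Only meaningful for \<open>mindex_size \<alpha> = d\<close>.\<close>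

definition multinomial :: "nat \<Rightarrow> nat ^ 'n::finite \<Rightarrow> real"
  where "multinomial d \<alpha> = fact d / (\<Prod>i\<in>UNIV. fact (\<alpha> $ i))"

definition normalized_coeff :: "nat \<Rightarrow> 'n::finite real_mpoly \<Rightarrow> nat ^ 'n \<Rightarrow> real"
  where "normalized_coeff d f \<alpha> = inverse (multinomial d \<alpha>) * Poly_Mapping.lookup f \<alpha>"

text \<open>
  The exponent vector \<open>\<alpha> + k (e\<^sub>i - e\<^sub>j)\<close>, computed over the integers. The conversion
  \<^const>\<open>nat\<close> truncates negative entries; \<open>int_shift\<close> gives a range of \<open>k\<close> in which
  none occur.
\<close>

definition shift :: "nat ^ 'n::finite \<Rightarrow> int \<Rightarrow> 'n \<Rightarrow> 'n \<Rightarrow> nat ^ 'n"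
  where "shift \<alpha> k i j =
    (\<chi> l. nat (((\<chi> m. int (\<alpha> $ m)) + k *s (axis i 1 - axis j 1)) $ l))"

lemma int_shift:
  fixes \<alpha> :: "nat ^ 'n::finite"
  assumes "- int (\<alpha> $ i) \<le> k" and "k \<le> int (\<alpha> $ j)"
  shows "(\<chi> l. int (shift \<alpha> k i j $ l)) = (\<chi> l. int (\<alpha> $ l)) + k *s (axis i 1 - axis j 1)"
  using assms by (auto simp: shift_def vec_eq_iff axis_def)

end

theory Submission
  imports Defs "HOL-Computational_Algebra.Fundamental_Theorem_Algebra"
begin

text \<open>
  If \<open>f\<close> is stable and homogeneous and the real vector \<open>u\<close> has positive entries, then for \<open>z\<close> in the
  product of upper half-planes all roots of \<open>t \<mapsto> f (z + t u)\<close> lie in the open lower half-plane; its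
  logarithmic derivative at 0 is therefore nonzero, and the derivative of \<open>f\<close> along \<open>u\<close> is again
  stable. Letting \<open>u\<close> tend to a basis vector, every partial derivative is a coefficientwise limit
  of stable forms. Differentiating down to degree 2 leaves a limit of stable quadratic forms whose
  polar values at the pairs from \<open>e\<^sub>i, e\<^sub>j\<close> are, up to the factor \<open>d!\<close>, the three normalized
  coefficients. For a stable quadratic form, \<open>v + t u\<close> is not a zero when \<open>u\<close> is positive, \<open>v\<close> is real
  and \<open>t\<close> is not real, so the discriminant in \<open>t\<close> is nonnegative, and this survives the limit.
\<close>

definition exp_monomial :: "complex ^ 'n::finite \<Rightarrow> nat ^ 'n \<Rightarrow> complex"
  where "exp_monomial z \<gamma> = (\<Prod>l\<in>UNIV. z $ l ^ (\<gamma> $ l) / fact (\<gamma> $ l))"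

definition exp_form :: "nat \<Rightarrow> (nat ^ 'n::finite \<Rightarrow> complex) \<Rightarrow> complex ^ 'n \<Rightarrow> complex"
  where "exp_form d b z = (\<Sum>\<gamma> | mindex_size \<gamma> = d. b \<gamma> * exp_monomial z \<gamma>)"

text \<open>
  Forms are given by coefficients \<open>b\<close> with respect to the divided powers \<open>z\<^sup>\<gamma> / \<gamma>!\<close>, for which a
  partial derivative is a mere translation of \<open>b\<close>.
\<close>

definition dir_deriv ::
    "'a::comm_semiring_1 ^ 'n::finite \<Rightarrow> (nat ^ 'n \<Rightarrow> 'a) \<Rightarrow> nat ^ 'n \<Rightarrow> 'a"
  where "dir_deriv u b \<gamma> = (\<Sum>l\<in>UNIV. u $ l * b (\<gamma> + axis l 1))"

definition stable_form :: "nat \<Rightarrow> (nat ^ 'n::finite \<Rightarrow> real) \<Rightarrow> bool"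
  where "stable_form d b \<longleftrightarrow>
    (\<forall>z. (\<forall>j. Im (z $ j) > 0) \<longrightarrow> exp_form d (\<lambda>\<gamma>. of_real (b \<gamma>)) z \<noteq> 0)"

text \<open>A partial derivative of a stable form can vanish identically, so stability itself is not
  inherited. Coefficientwise limits are, and they preserve the non-strict inequality sought.\<close>

definition stable_limit :: "nat \<Rightarrow> (nat ^ 'n::finite \<Rightarrow> real) \<Rightarrow> bool"
  where "stable_limit d b \<longleftrightarrow>
    (\<exists>c. (\<forall>k. stable_form d (c k)) \<and> (\<forall>\<gamma>. (\<lambda>k. c k \<gamma>) \<longlonglongrightarrow> b \<gamma>))"

section \<open>Multi-indices of fixed size\<close>

lemma mindex_size_add: "mindex_size (\<alpha> + \<beta>) = mindex_size \<alpha> + mindex_size \<beta>"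
  by (simp add: mindex_size_def sum.distrib)

lemma mindex_size_axis [simp]: "mindex_size (axis l (Suc 0)) = 1"
  by (simp add: mindex_size_def axis_def)

lemma mindex_size_0 [simp]: "mindex_size 0 = 0"
  by (simp add: mindex_size_def)

lemma mindex_size_eq_0 [simp]: "mindex_size \<alpha> = 0 \<longleftrightarrow> \<alpha> = 0"
  by (auto simp: mindex_size_def vec_eq_iff)

lemma finite_mindex_size [simp]: "finite {\<gamma> :: nat ^ 'n::finite. mindex_size \<gamma> = d}"
proof (rule finite_imageD)
  have "\<gamma> $ i \<le> mindex_size \<gamma>" for \<gamma> :: "nat ^ 'n" and i
    unfolding mindex_size_def by (rule member_le_sum) auto
  then have "vec_nth ` {\<gamma> :: nat ^ 'n. mindex_size \<gamma> = d} \<subseteq> PiE UNIV (\<lambda>_. {..d})"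
    by auto
  then show "finite (vec_nth ` {\<gamma> :: nat ^ 'n. mindex_size \<gamma> = d})"
    by (rule finite_subset) (simp add: finite_PiE)
  show "inj_on vec_nth {\<gamma> :: nat ^ 'n. mindex_size \<gamma> = d}"
    by (simp add: inj_on_def vec_nth_inject)
qed

lemma axis_add_diff: "\<gamma> $ l > 0 \<Longrightarrow> \<gamma> - axis l (Suc 0) + axis l (Suc 0) = (\<gamma> :: nat ^ 'n::finite)"
  by (auto simp: vec_eq_iff axis_def)

text \<open>Moves a translation from the coefficients to the monomials. Indices with entry 0 at
  \<open>l\<close> are not translates, and there the truncated difference would give a wrong
  monomial, hence the guard.\<close>

lemma sum_mindex_shift:
  fixes g :: "nat ^ 'n::finite \<Rightarrow> complex"
  shows "(\<Sum>\<gamma> | mindex_size \<gamma> = d. g (\<gamma> + axis l 1) * h \<gamma>) =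
    (\<Sum>\<delta> | mindex_size \<delta> = Suc d. if \<delta> $ l = 0 then 0 else g \<delta> * h (\<delta> - axis l 1))"
    (is "?L = ?R")
proof -
  have "?R = (\<Sum>\<delta> | mindex_size \<delta> = Suc d \<and> \<delta> $ l > 0. g \<delta> * h (\<delta> - axis l 1))"
    by (rule sum.mono_neutral_cong_right) auto
  also have "\<dots> = ?L"
  proof (rule sum.reindex_bij_witness[where i = "\<lambda>\<gamma>. \<gamma> + axis l 1" and j = "\<lambda>\<delta>. \<delta> - axis l 1"])
    fix \<delta> :: "nat ^ 'n" assume \<delta>: "\<delta> \<in> {\<delta>. mindex_size \<delta> = Suc d \<and> \<delta> $ l > 0}"
    then have "mindex_size (\<delta> - axis l (Suc 0) + axis l (Suc 0)) = Suc d"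
      by (simp add: axis_add_diff)
    then show "\<delta> - axis l 1 \<in> {\<gamma>. mindex_size \<gamma> = d}"
      by (simp add: mindex_size_add)
  qed (auto simp: axis_add_diff mindex_size_add)
  finally show ?thesis by simp
qed

section \<open>Directional derivatives and Euler's identity\<close>

lemma has_field_derivative_exp_power:
  "((\<lambda>t. (a + t * c) ^ k / fact k) has_field_derivative
    c * (if k = 0 then 0 else a ^ (k - 1) / fact (k - 1))) (at (0::complex))"
proof (cases k)
  case (Suc m)
  have "((\<lambda>t. (a + t * c) ^ Suc m / fact (Suc m)) has_field_derivative
      (of_nat (Suc m) * a ^ m * c) / fact (Suc m)) (at 0)"
    by (rule DERIV_cdivide) (rule derivative_eq_intros refl | simp)+
  moreover have "(of_nat (Suc m) * a ^ m * c) / fact (Suc m) = c * (a ^ m / fact m)"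
    by (simp add: fact_Suc field_simps del: of_nat_Suc)
  ultimately show ?thesis
    using Suc by simp
qed simp

lemma has_field_derivative_exp_monomial:
  fixes z u :: "complex ^ 'n::finite"
  shows "((\<lambda>t. exp_monomial (z + t *s u) \<delta>) has_field_derivative
    (\<Sum>l\<in>UNIV. u $ l * (if \<delta> $ l = 0 then 0 else exp_monomial z (\<delta> - axis l 1)))) (at 0)"
proof -
  have eq: "(u $ l * (if \<delta> $ l = 0 then 0 else z $ l ^ (\<delta> $ l - 1) / fact (\<delta> $ l - 1))) *
      (\<Prod>m\<in>UNIV - {l}. (z $ m + 0 * u $ m) ^ (\<delta> $ m) / fact (\<delta> $ m)) =
      u $ l * (if \<delta> $ l = 0 then 0 else exp_monomial z (\<delta> - axis l 1))" for l
  proof -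
    have "exp_monomial z (\<delta> - axis l 1) = z $ l ^ (\<delta> $ l - 1) / fact (\<delta> $ l - 1) *
        (\<Prod>m\<in>UNIV - {l}. z $ m ^ (\<delta> $ m) / fact (\<delta> $ m))"
      unfolding exp_monomial_def
      by (subst prod.remove[of UNIV l]) (auto simp: axis_def intro!: prod.cong)
    then show ?thesis by simp
  qed
  have "((\<lambda>t. \<Prod>l\<in>UNIV. (z $ l + t * u $ l) ^ (\<delta> $ l) / fact (\<delta> $ l)) has_field_derivative
     (\<Sum>l\<in>UNIV. (u $ l * (if \<delta> $ l = 0 then 0 else z $ l ^ (\<delta> $ l - 1) / fact (\<delta> $ l - 1))) *
      (\<Prod>m\<in>UNIV - {l}. (z $ m + 0 * u $ m) ^ (\<delta> $ m) / fact (\<delta> $ m)))) (at 0)"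
    by (rule has_field_derivative_prod has_field_derivative_exp_power)+
  then show ?thesis
    unfolding eq by (simp add: exp_monomial_def)
qed

lemma has_field_derivative_exp_form:
  "((\<lambda>t. exp_form (Suc d) b (z + t *s u)) has_field_derivative
    exp_form d (dir_deriv u b) z) (at 0)"
proof -
  have "exp_form d (dir_deriv u b) z =
    (\<Sum>l\<in>UNIV. u $ l * (\<Sum>\<gamma> | mindex_size \<gamma> = d. b (\<gamma> + axis l 1) * exp_monomial z \<gamma>))"
    unfolding exp_form_def dir_deriv_def sum_distrib_left sum_distrib_right
    by (subst sum.swap) (simp add: mult.assoc)
  also have "\<dots> = (\<Sum>l\<in>UNIV. \<Sum>\<delta> | mindex_size \<delta> = Suc d.
      b \<delta> * (u $ l * (if \<delta> $ l = 0 then 0 else exp_monomial z (\<delta> - axis l 1))))"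
    unfolding sum_mindex_shift sum_distrib_left by (intro sum.cong) auto
  also have "\<dots> = (\<Sum>\<delta> | mindex_size \<delta> = Suc d. b \<delta> *
      (\<Sum>l\<in>UNIV. u $ l * (if \<delta> $ l = 0 then 0 else exp_monomial z (\<delta> - axis l 1))))"
    by (subst sum.swap) (simp add: sum_distrib_left)
  finally have eq: "exp_form d (dir_deriv u b) z = \<dots>" .
  show ?thesis
    unfolding eq unfolding exp_form_def
    by (intro DERIV_sum DERIV_cmult has_field_derivative_exp_monomial)
qed

lemma exp_form_scale: "exp_form d b (c *s z) = c ^ d * exp_form d b z"
proof -
  have "exp_monomial (c *s z) \<gamma> = c ^ mindex_size \<gamma> * exp_monomial z \<gamma>" for \<gamma>
    by (simp add: exp_monomial_def mindex_size_def power_mult_distrib prod.distrib power_sum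
        flip: times_divide_eq_right)
  then show ?thesis
    by (simp add: exp_form_def sum_distrib_left mult_ac)
qed

text \<open>On the line through \<open>z\<close> in direction \<open>z\<close> the form is
  \<open>(1 + t) ^ Suc d\<close> times its value at \<open>z\<close>; differentiate at 0.\<close>

lemma euler_exp_form: "exp_form d (dir_deriv z b) z = of_nat (Suc d) * exp_form (Suc d) b z"
proof (rule DERIV_unique)
  show "((\<lambda>t. exp_form (Suc d) b (z + t *s z)) has_field_derivative
      exp_form d (dir_deriv z b) z) (at 0)"
    by (rule has_field_derivative_exp_form)
  have "z + t *s z = (1 + t) *s z" for t
    by (simp add: vec_eq_iff algebra_simps)
  moreover have "((\<lambda>t. (1 + t) ^ Suc d * exp_form (Suc d) b z) has_field_derivative
      of_nat (Suc d) * exp_form (Suc d) b z) (at 0)"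
    by (rule derivative_eq_intros refl | simp)+
  ultimately show "((\<lambda>t. exp_form (Suc d) b (z + t *s z)) has_field_derivative
      of_nat (Suc d) * exp_form (Suc d) b z) (at 0)"
    by (simp only: exp_form_scale)
qed

text \<open>Euler's identity applied twice. This expresses a quadratic form through its polar form,
  whose value at two vectors is the iterated \<open>dir_deriv\<close> at index 0.\<close>

lemma exp_form_2: "2 * exp_form 2 b z = dir_deriv z (dir_deriv z b) 0"
proof -
  have "2 * exp_form 2 b z = exp_form 0 (dir_deriv z (dir_deriv z b)) z"
    using euler_exp_form[of 1 z b] euler_exp_form[of 0 z "dir_deriv z b"]
    by (simp add: numeral_2_eq_2)
  then show ?thesis
    by (simp add: exp_form_def exp_monomial_def)
qed

section \<open>Stability of derivatives along positive vectors\<close>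

lemma exp_form_line_poly: "\<exists>p. \<forall>t. poly p t = exp_form d b (z + t *s u)"
proof (intro exI allI)
  fix t
  show "poly (\<Sum>\<gamma> | mindex_size \<gamma> = d. smult (b \<gamma>)
      (\<Prod>l\<in>UNIV. smult (1 / fact (\<gamma> $ l)) ([:z $ l, u $ l:] ^ (\<gamma> $ l)))) t =
    exp_form d b (z + t *s u)"
    by (simp add: exp_form_def exp_monomial_def poly_sum poly_prod)
qed

text \<open>The logarithmic derivative at 0 is the sum of \<open>-1/r\<close> over the roots \<open>r\<close>.\<close>

lemma Im_log_deriv_neg:
  fixes p :: "complex poly"
  assumes "\<And>t. Im t \<ge> 0 \<Longrightarrow> poly p t \<noteq> 0" and "degree p > 0"
  shows "Im (poly (pderiv p) 0 / poly p 0) < 0"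
  using assms
proof (induction "degree p" arbitrary: p)
  case (Suc n)
  then obtain r where r: "poly p r = 0"
    using fundamental_theorem_of_algebra by (metis constant_degree not_less_zero)
  then obtain q where q: "p = [:- r, 1:] * q"
    by (metis dvdE poly_eq_0_iff_dvd)
  have Imr: "Im r < 0"
    using Suc.prems(1)[of r] r by linarith
  have q0: "poly q t \<noteq> 0" if "Im t \<ge> 0" for t
    using Suc.prems(1)[OF that] q by auto
  then have "q \<noteq> 0" using q0[of 0] by fastforce
  then have deg: "degree p = Suc (degree q)"
    using q degree_mult_eq[of "[:- r, 1:]" q] by simp
  \<comment> \<open>A constant \<open>q\<close> contributes 0, so the inequality for the remaining
    roots is only weak; strictness comes from \<open>r\<close>.\<close>
  have le: "Im (poly (pderiv q) 0 / poly q 0) \<le> 0"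
  proof (cases "degree q = 0")
    case True
    then show ?thesis by (simp add: pderiv_eq_0_iff[THEN iffD2])
  next
    case False
    then show ?thesis
      using Suc.hyps(1)[of q] Suc.hyps(2) deg q0 by force
  qed
  have "r \<noteq> 0" "poly q 0 \<noteq> 0"
    using Imr q0 by auto
  then have "poly (pderiv p) 0 / poly p 0 = - inverse r + poly (pderiv q) 0 / poly q 0"
    unfolding q pderiv_mult by (simp add: field_simps pderiv_pCons)
  \<comment> \<open>The imaginary part of -1/r is Im r / |r|^2.\<close>
  moreover have "Im (- inverse r) < 0"
    using Imr by (simp add: divide_neg_pos sum_power2_gt_zero_iff)
  ultimately show ?case
    using le by simp
qed simp

lemma stable_form_dir_deriv:
  fixes u :: "real ^ 'n::finite"
  assumes b: "stable_form (Suc d) b" and u: "\<And>l. u $ l > 0"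
  shows "stable_form d (dir_deriv u b)"
  unfolding stable_form_def
proof (intro allI impI)
  fix z :: "complex ^ 'n" assume z: "\<forall>j. Im (z $ j) > 0"
  define B where "B = (\<lambda>\<gamma>. complex_of_real (b \<gamma>))"
  define U where "U = (\<chi> l. complex_of_real (u $ l))"
  have B: "exp_form (Suc d) B w \<noteq> 0" if "\<And>j. Im (w $ j) > 0" for w
    using b that by (simp add: stable_form_def B_def)
  \<comment> \<open>The point iU lies in the product of upper half-planes, and by homogeneity the
    value there is a power of i times the value at \<open>U\<close>.\<close>
  have U: "exp_form (Suc d) B U \<noteq> 0"
    using B[of "\<i> *s U"] u unfolding exp_form_scale by (auto simp: U_def)
  obtain p where p: "\<And>t. poly p t = exp_form (Suc d) B (z + t *s U)"
    using exp_form_line_poly by metis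
  \<comment> \<open>\<open>q\<close> is \<open>p\<close> with its coefficients reversed in degree
    \<open>Suc d\<close>: q(s) = s^(d+1) p(1/s). So q(0), the value at \<open>U\<close>, is the top
    coefficient of \<open>p\<close>.\<close>
  obtain q where q: "\<And>t. poly q t = exp_form (Suc d) B (U + t *s z)"
    using exp_form_line_poly by metis
  have nz: "poly p t \<noteq> 0" if "Im t \<ge> 0" for t
    unfolding p by (rule B) (use z u that in \<open>auto simp: U_def less_imp_le intro!: add_pos_nonneg mult_nonneg_nonneg\<close>)
  have "degree p \<noteq> 0"
  proof
    assume "degree p = 0"
    then obtain c where c: "p = [:c:]"
      by (metis degree_eq_zeroE)
    have "poly q s = s ^ Suc d * c" if "s \<noteq> 0" for s
    proof -
      have "U + s *s z = s *s (z + inverse s *s U)"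
        using that by (simp add: vec_eq_iff field_simps)
      then show ?thesis
        using p[of "inverse s"] c by (simp only: q exp_form_scale) simp
    qed
    \<comment> \<open>The formula for \<open>q\<close> is known only off 0; continuity extends it to
      0 and forces the value at \<open>U\<close> to vanish.\<close>
    then have "((\<lambda>s. s ^ Suc d * c) \<longlongrightarrow> poly q 0) (at 0)"
      by (intro Lim_transform_eventually[OF poly_isCont[unfolded isCont_def]])
        (auto simp: eventually_at_filter)
    moreover have "((\<lambda>s. s ^ Suc d * c) \<longlongrightarrow> 0 ^ Suc d * c) (at 0)"
      by (intro tendsto_intros)
    ultimately have "poly q 0 = 0 ^ Suc d * c"
      by (intro tendsto_unique[OF trivial_limit_at])
    then show False
      using U q[of 0] by simp
  qed
  then have "poly (pderiv p) 0 \<noteq> 0"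
    using Im_log_deriv_neg[OF nz] by fastforce
  moreover have "poly (pderiv p) 0 = exp_form d (dir_deriv U B) z"
    using has_field_derivative_exp_form[of d B z U] poly_DERIV[of p 0]
    unfolding p[symmetric] by (rule DERIV_unique[rotated])
  moreover have "dir_deriv U B = (\<lambda>\<gamma>. of_real (dir_deriv u b \<gamma>))"
    by (simp add: dir_deriv_def fun_eq_iff U_def B_def)
  ultimately show "exp_form d (\<lambda>\<gamma>. of_real (dir_deriv u b \<gamma>)) z \<noteq> 0"
    by simp
qed

section \<open>Partial derivatives as limits of stable forms\<close>

lemma tendsto_dir_deriv:
  fixes u :: "'b \<Rightarrow> real ^ 'n::finite"
  assumes "(u \<longlongrightarrow> v) F" and "\<And>\<gamma>. ((\<lambda>k. c k \<gamma>) \<longlongrightarrow> b \<gamma>) F"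
  shows "((\<lambda>k. dir_deriv (u k) (c k) \<gamma>) \<longlongrightarrow> dir_deriv v b \<gamma>) F"
  unfolding dir_deriv_def by (intro tendsto_intros assms)

lemma dir_deriv_axis: "dir_deriv (axis l 1) b = (\<lambda>\<gamma>. b (\<gamma> + axis l 1))"
  by (simp add: dir_deriv_def fun_eq_iff axis_def if_distrib[where f = "\<lambda>x. x * _"] cong: if_cong)

lemma dir_deriv_commute: "dir_deriv u (dir_deriv v b) = dir_deriv v (dir_deriv u b)"
proof
  fix \<gamma>
  show "dir_deriv u (dir_deriv v b) \<gamma> = dir_deriv v (dir_deriv u b) \<gamma>"
    unfolding dir_deriv_def sum_distrib_left
    by (subst sum.swap) (simp add: mult_ac add_ac)
qed

lemma dir_deriv_line:
  "dir_deriv (v + t *s u) b \<gamma> = dir_deriv v b \<gamma> + t * dir_deriv u b \<gamma>"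
  by (simp add: dir_deriv_def sum_distrib_left sum.distrib algebra_simps)

definition perturbed_axis :: "'n::finite \<Rightarrow> nat \<Rightarrow> real ^ 'n"
  where "perturbed_axis i k = (\<chi> l. axis i 1 $ l + inverse (real (Suc k)))"

lemma perturbed_axis_pos: "perturbed_axis i k $ l > 0"
  by (simp add: perturbed_axis_def axis_def add_pos_pos)

lemma perturbed_axis_tendsto: "perturbed_axis i \<longlonglongrightarrow> axis i 1"
proof (rule vec_tendstoI)
  fix l
  have "(\<lambda>k. axis i 1 $ l + inverse (real (Suc k))) \<longlonglongrightarrow> axis i 1 $ l + 0"
    by (intro tendsto_intros LIMSEQ_inverse_real_of_nat)
  then show "(\<lambda>k. perturbed_axis i k $ l) \<longlonglongrightarrow> axis i 1 $ l"
    by (simp add: perturbed_axis_def)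
qed

text \<open>\<open>dir_deriv\<close> is jointly continuous in direction and coefficients, so pairing
  the \<open>k\<close>-th approximant with the \<open>k\<close>-th perturbed direction gives a
  single suitable sequence.\<close>

lemma stable_limit_axis:
  assumes "stable_limit (Suc d) b"
  shows "stable_limit d (\<lambda>\<gamma>. b (\<gamma> + axis l 1))"
proof -
  obtain c where c: "\<And>k. stable_form (Suc d) (c k)" "\<And>\<gamma>. (\<lambda>k. c k \<gamma>) \<longlonglongrightarrow> b \<gamma>"
    using assms by (auto simp: stable_limit_def)
  have "stable_form d (dir_deriv (perturbed_axis l k) (c k))" for k
    by (intro stable_form_dir_deriv c perturbed_axis_pos)
  moreover have "(\<lambda>k. dir_deriv (perturbed_axis l k) (c k) \<gamma>) \<longlonglongrightarrow> b (\<gamma> + axis l 1)" for \<gamma>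
    using tendsto_dir_deriv[OF perturbed_axis_tendsto c(2)] by (simp add: dir_deriv_axis)
  ultimately show ?thesis
    unfolding stable_limit_def by (intro exI[of _ "\<lambda>k. dir_deriv (perturbed_axis l k) (c k)"]) blast
qed

text \<open>Translation by \<beta> is the partial derivative of order \<beta>; the induction peels
  off one unit vector at a time.\<close>

lemma stable_limit_translate:
  assumes "stable_limit (d + mindex_size \<beta>) b"
  shows "stable_limit d (\<lambda>\<gamma>. b (\<gamma> + \<beta>))"
  using assms
proof (induction "mindex_size \<beta>" arbitrary: \<beta> b)
  case 0
  then have "\<beta> = 0" by simp
  then show ?case using "0.prems" by simp
next
  case (Suc n)
  then have "\<beta> \<noteq> 0" by (metis mindex_size_eq_0 nat.distinct(1))
  then obtain l where l: "\<beta> $ l > 0"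
    by (auto simp: vec_eq_iff)
  define \<beta>' where "\<beta>' = \<beta> - axis l 1"
  have \<beta>: "\<beta> = \<beta>' + axis l 1"
    using l by (simp add: \<beta>'_def axis_add_diff)
  then have n: "n = mindex_size \<beta>'"
    using Suc.hyps(2) by (simp add: mindex_size_add)
  have "stable_limit (d + mindex_size \<beta>') (\<lambda>\<gamma>. b (\<gamma> + axis l 1))"
    using Suc.prems by (intro stable_limit_axis) (simp add: \<beta> mindex_size_add)
  from Suc.hyps(1)[OF n this] show ?case
    by (simp add: \<beta> add_ac)
qed

section \<open>Discriminants of quadratic forms\<close>

lemma stable_form_discriminant:
  fixes u v :: "real ^ 'n::finite"
  assumes b: "stable_form 2 b" and u: "\<And>l. u $ l > 0"
  shows "(dir_deriv u (dir_deriv v b) 0)\<^sup>2 \<ge>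
    dir_deriv u (dir_deriv u b) 0 * dir_deriv v (dir_deriv v b) 0"
proof (rule ccontr)
  define P Q R where "P = dir_deriv u (dir_deriv u b) 0" and "Q = dir_deriv u (dir_deriv v b) 0"
    and "R = dir_deriv v (dir_deriv v b) 0"
  assume "\<not> ?thesis"
  then have less: "Q\<^sup>2 < P * R" by (simp add: P_def Q_def R_def)
  then have P0: "P \<noteq> 0" by (auto simp: not_less)
  define s where "s = sqrt (P * R - Q\<^sup>2)"
  have s: "s > 0" "s\<^sup>2 = P * R - Q\<^sup>2" using less by (auto simp: s_def)
  \<comment> \<open>The root of R + 2Qt + Pt^2 in the upper half-plane; the absolute value makes its
    imaginary part positive for either sign of \<open>P\<close>.\<close>
  define t where "t = Complex (- Q / P) (s / \<bar>P\<bar>)"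
  have root: "of_real R + 2 * t * of_real Q + t\<^sup>2 * of_real P = 0"
  proof -
    have "R + 2 * (- Q / P) * Q + ((- Q / P)\<^sup>2 - (s / \<bar>P\<bar>)\<^sup>2) * P = 0"
      using P0 by (simp add: power_divide s(2)) (simp add: field_simps power2_eq_square)
    moreover have "2 * (s / \<bar>P\<bar>) * Q + 2 * (- Q / P) * (s / \<bar>P\<bar>) * P = 0"
      using P0 by (simp add: field_simps)
    ultimately show ?thesis
      by (simp add: complex_eq_iff t_def power2_eq_square algebra_simps)
  qed
  define B where "B = (\<lambda>\<gamma>. complex_of_real (b \<gamma>))"
  define U V where "U = (\<chi> l. complex_of_real (u $ l))" and "V = (\<chi> l. complex_of_real (v $ l))"
  \<comment> \<open>\<open>dir_deriv_line\<close> expands the outer direction; commuting the two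
    derivatives carries this to the inner one.\<close>
  have lin: "dir_deriv w (dir_deriv (V + t *s U) B) 0 =
      dir_deriv w (dir_deriv V B) 0 + t * dir_deriv w (dir_deriv U B) 0" for w
    unfolding dir_deriv_commute[of w "V + t *s U"] dir_deriv_line
      dir_deriv_commute[of V w] dir_deriv_commute[of U w]
    by (rule refl)
  have "2 * exp_form 2 B (V + t *s U) =
      dir_deriv V (dir_deriv V B) 0 + t * dir_deriv V (dir_deriv U B) 0
      + t * (dir_deriv U (dir_deriv V B) 0 + t * dir_deriv U (dir_deriv U B) 0)"
    unfolding exp_form_2 lin dir_deriv_line dir_deriv_commute[of V U]
    by (simp add: algebra_simps)
  also have "\<dots> = of_real R + 2 * t * of_real Q + t\<^sup>2 * of_real P"
  proof -
    have "dir_deriv U (dir_deriv U B) 0 = of_real P" "dir_deriv U (dir_deriv V B) 0 = of_real Q"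
      "dir_deriv V (dir_deriv V B) 0 = of_real R"
      by (simp_all add: dir_deriv_def U_def V_def B_def P_def Q_def R_def)
    then show ?thesis
      by (simp add: dir_deriv_commute[of V U] algebra_simps power2_eq_square)
  qed
  finally have "exp_form 2 B (V + t *s U) = 0"
    using root by simp
  moreover have "\<forall>j. Im ((V + t *s U) $ j) > 0"
    using u s(1) P0 by (simp add: U_def V_def t_def)
  ultimately show False
    using b by (simp add: stable_form_def B_def)
qed

lemma stable_limit_discriminant:
  assumes "stable_limit 2 b"
  shows "(b (axis i 1 + axis j 1))\<^sup>2 \<ge> b (axis i 1 + axis i 1) * b (axis j 1 + axis j 1)"
proof -
  obtain c where c: "\<And>k. stable_form 2 (c k)" "\<And>\<gamma>. (\<lambda>k. c k \<gamma>) \<longlonglongrightarrow> b \<gamma>"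
    using assms by (auto simp: stable_limit_def)
  \<comment> \<open>The discriminant inequality asks for positivity of one direction only, so
    \<open>axis j 1\<close> stays unperturbed.\<close>
  let ?u = "\<lambda>k. perturbed_axis i k" and ?e = "axis i 1" and ?v = "axis j 1 :: real ^ 'a"
  have "dir_deriv ?e (dir_deriv ?e b) 0 * dir_deriv ?v (dir_deriv ?v b) 0 \<le>
      (dir_deriv ?e (dir_deriv ?v b) 0)\<^sup>2"
  proof (rule LIMSEQ_le)
    show "(\<lambda>k. dir_deriv (?u k) (dir_deriv (?u k) (c k)) 0 * dir_deriv ?v (dir_deriv ?v (c k)) 0)
      \<longlonglongrightarrow> dir_deriv ?e (dir_deriv ?e b) 0 * dir_deriv ?v (dir_deriv ?v b) 0"
      by (intro tendsto_mult tendsto_dir_deriv perturbed_axis_tendsto tendsto_const c)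
    show "(\<lambda>k. (dir_deriv (?u k) (dir_deriv ?v (c k)) 0)\<^sup>2) \<longlonglongrightarrow>
        (dir_deriv ?e (dir_deriv ?v b) 0)\<^sup>2"
      by (intro tendsto_power tendsto_dir_deriv perturbed_axis_tendsto tendsto_const c)
  qed (use stable_form_discriminant[OF c(1) perturbed_axis_pos] in blast)
  then show ?thesis
    by (simp add: dir_deriv_axis add.commute)
qed

section \<open>Return to normalized coefficients\<close>

lemma exp_form_mpoly_eval:
  assumes "homogeneous d f"
  shows "exp_form d (\<lambda>\<gamma>. of_real ((\<Prod>l\<in>UNIV. fact (\<gamma> $ l)) * Poly_Mapping.lookup f \<gamma>)) z =
    mpoly_eval f z"
proof -
  have "exp_form d (\<lambda>\<gamma>. of_real ((\<Prod>l\<in>UNIV. fact (\<gamma> $ l)) * Poly_Mapping.lookup f \<gamma>)) z =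
    (\<Sum>\<gamma> | mindex_size \<gamma> = d. of_real (Poly_Mapping.lookup f \<gamma>) * monomial_eval z \<gamma>)"
    unfolding exp_form_def by (intro sum.cong) (auto simp: exp_monomial_def monomial_eval_def prod_dividef)
  also have "\<dots> = mpoly_eval f z"
    unfolding mpoly_eval_def
    by (rule sum.mono_neutral_right) (use assms in \<open>auto simp: homogeneous_def in_keys_iff\<close>)
  finally show ?thesis .
qed

theorem theorem3p2:
  fixes f :: "'n::finite real_mpoly" and d :: nat
    and \<alpha> :: "nat ^ 'n" and i j :: 'n and k :: int
  assumes "homogeneous d f"
    and "real_stable f"
    and "mindex_size \<alpha> = d"
    and "\<alpha> $ i \<ge> \<alpha> $ j" and "\<alpha> $ j > 0"
    and "- int (\<alpha> $ i) + 1 \<le> k" and "k \<le> int (\<alpha> $ j) - 1"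
  shows "(normalized_coeff d f (shift \<alpha> k i j))\<^sup>2
    \<ge> normalized_coeff d f (shift \<alpha> (k - 1) i j) * normalized_coeff d f (shift \<alpha> (k + 1) i j)"
proof (cases "i = j")
  case True
  then have "shift \<alpha> m i j = \<alpha>" for m
    by (simp add: shift_def vec_eq_iff)
  then show ?thesis by (simp add: power2_eq_square)
next
  case False
  define b where "b \<gamma> = (\<Prod>l\<in>UNIV. fact (\<gamma> $ l)) * Poly_Mapping.lookup f \<gamma>" for \<gamma>
  \<comment> \<open>The bounds on \<open>k\<close> make the entries of
    \<open>shift \<alpha> k i j\<close> at \<open>i\<close> and \<open>j\<close> at least 1, so the
    truncated subtraction is exact. The three exponents become \<beta> plus a sum of two vectors
    from \<open>axis i 1\<close>, \<open>axis j 1\<close>.\<close>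
  define \<beta> where "\<beta> = shift \<alpha> k i j - axis i 1 - axis j 1"
  have shifts: "shift \<alpha> k i j = axis i 1 + axis j 1 + \<beta>"
    "shift \<alpha> (k + 1) i j = axis i 1 + axis i 1 + \<beta>"
    "shift \<alpha> (k - 1) i j = axis j 1 + axis j 1 + \<beta>"
    using False assms(6,7) by (auto simp: \<beta>_def shift_def vec_eq_iff axis_def)
  have "int (shift \<alpha> k i j $ l) = int (\<alpha> $ l) + k * ((if l = i then 1 else 0) - (if l = j then 1 else 0))"
    for l
    using False assms(6,7) by (auto simp: shift_def axis_def)
  then have "int (mindex_size (shift \<alpha> k i j)) = int (mindex_size \<alpha>)"
    by (simp add: mindex_size_def sum.distrib sum_subtractf flip: sum_distrib_left)
  then have d: "d = 2 + mindex_size \<beta>"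
    using assms(3) by (simp add: shifts mindex_size_add)
  have "stable_form d b"
    using assms(2) exp_form_mpoly_eval[OF assms(1)] by (simp add: stable_form_def real_stable_def b_def)
  then have "stable_limit d b"
    unfolding stable_limit_def by (intro exI[of _ "\<lambda>_. b"]) simp
  then have "stable_limit 2 (\<lambda>\<gamma>. b (\<gamma> + \<beta>))"
    unfolding d by (rule stable_limit_translate)
  from stable_limit_discriminant[OF this, of i j]
  have "b (shift \<alpha> (k + 1) i j) * b (shift \<alpha> (k - 1) i j) \<le> (b (shift \<alpha> k i j))\<^sup>2"
    by (simp add: shifts)
  \<comment> \<open>All three coefficients share the factor 1/d!, so it cancels from the
    inequality.\<close>
  moreover have "normalized_coeff d f \<gamma> = b \<gamma> / fact d" for \<gamma>
    by (simp add: normalized_coeff_def multinomial_def b_def)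
  ultimately show ?thesis
    by (simp add: power_divide divide_right_mono power2_eq_square mult.commute)
qed

end
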